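(* Let $n\ge 1$. There is a bijection between the regions of the type $C_n$ Shi arrangement $\mathcal{S}^C_n$ in $\mathbb{R}^n$ and the set of sequences $$\mathcal{A}^C(n)=\{(a_1,a_2,\dots,a_n)\mid a_i\in\{-n,-n+1,\dots,-1,0,1,\dots,n-1,n\},\ 1\le i\le n\}.$$
   Context: The regions of a finite set $\mathcal{H}$ of affine hyperplanes in $\mathbb{R}^n$ are the connected components of $\mathbb{R}^n\setminus\bigcup_{H\in\mathcal{H}}H$. The type $C_n$ Shi arrangement in $\mathbb{R}^n$ is $$\mathcal{S}^C_n=\{x_i-x_j=0,\ x_i+x_j=0,\ 2x_k=0\mid 1\le i<j\le n,\ 1\le k\le n\}\cup\{x_i-x_j=1,\ x_i+x_j=1,\ 2x_k=1\mid 1\le i<j\le n,\ 1\le k\le n\}.$$ *)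

theory Defs
  imports "HOL-Analysis.Analysis"
begin

(* The ordered index set 1 < ... < n is a finite linearly ordered type 'n, so n is CARD('n) >= 1.
   All linear orders on n elements are isomorphic, so the choice of order is immaterial. *)

definition regions :: "(real ^ 'n) set set \<Rightarrow> (real ^ 'n) set set" where
  "regions \<H> = components (UNIV - \<Union>\<H>)"

definition shi_C :: "(real ^ 'n::{finite,linorder}) set set" where
  "shi_C =
     {{x. x $ i - x $ j = 0} | i j. i < j} \<union>
     {{x. x $ i + x $ j = 0} | i j. i < j} \<union>
     {{x. 2 * x $ k = 0} | k. True} \<union>
     {{x. x $ i - x $ j = 1} | i j. i < j} \<union>
     {{x. x $ i + x $ j = 1} | i j. i < j} \<union>
     {{x. 2 * x $ k = 1} | k. True}"

definition seqs_C :: "(int ^ 'n) set" where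
  "seqs_C = {a. \<forall>i. a $ i \<in> {- int CARD('n)..int CARD('n)}}"

end

theory Submission
  imports Defs "HOL-Number_Theory.Cong" "HOL-Computational_Algebra.Polynomial"
begin

text \<open>
Both sides are finite, so it is enough that the arrangement has \<open>(2n + 1)^n\<close> regions. The count
goes by the finite field method of Athanasiadis. Let \<open>f\<close> be one of the affine forms that define an
arrangement. A region of the arrangement without \<open>f\<close> is cut in two by the hyperplane \<open>f = 0\<close>
exactly when it meets that hyperplane, so the numbers of regions satisfy
\<open>r(A) = r(A - f) + r(A restricted to f = 0)\<close>. The points modulo a prime \<open>p\<close> at which no form
vanishes satisfy the same recursion with a minus sign, because those of \<open>A - f\<close> on which \<open>f\<close> vanishes
are the points of the restriction. Hence both counts come from one integer polynomial \<open>\<chi>\<close>: the number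
of points is \<open>\<chi>(p)\<close> for every large prime \<open>p\<close>, and the number of regions in dimension \<open>n\<close> is
\<open>(-1)^n \<chi>(-1)\<close> (theorem \<open>characteristic_polynomial\<close>).

For the type C Shi arrangement the points modulo \<open>p\<close> can be counted directly. Write the coordinates
\<open>x_k\<close> and their negatives as \<open>2n\<close> labels on the cycle of residues, symmetric under negation. The
forms are nonzero at \<open>x\<close> exactly when \<open>0\<close> carries no label, no residue carries two
labels, and the labels on consecutive residues increase in the order
\<open>1 < ... < n < -n < ... < -1\<close>. Such a placement is determined by the gap, among the \<open>p - 2n\<close> gaps
between cyclically consecutive empty residues, into which each label falls, since inside a gap the order is
forced. By symmetry only the gaps of the \<open>n\<close> coordinates are free, and they can be chosen
arbitrarily, so there are \<open>(p - 2n)^n\<close> points (lemma \<open>card_residue_points_shi\<close>). Therefore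
\<open>\<chi>(t) = (t - 2n)^n\<close>, and \<open>(-1)^n \<chi>(-1) = (2n + 1)^n\<close>.

That regions are the same as realisable sign vectors of the defining forms follows because
the set of points with a given sign vector is open and convex (lemma \<open>components_eq_cells\<close>).
\<close>

section \<open>Integral affine forms\<close>

text \<open>
A pair \<open>(c, a)\<close> stands for the affine form \<open>c + (\<Sum>i\<in>I. a i * x i)\<close>. The set \<open>I\<close> of coordinates is
a parameter, and not a type, because restriction to a hyperplane removes a coordinate. The coefficients
are integers and the points range over any commutative ring, so that the same form can be
read over the reals and modulo a prime.
\<close>

definition aeval :: "'a set \<Rightarrow> int \<times> ('a \<Rightarrow> int) \<Rightarrow> ('a \<Rightarrow> 'r::comm_ring_1) \<Rightarrow> 'r" where
  "aeval I f x = of_int (fst f) + (\<Sum>i\<in>I. of_int (snd f i) * x i)"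

text \<open>
Restriction of \<open>g\<close> to the hyperplane \<open>f = 0\<close>, with the coordinate \<open>k\<close> solved for. Denominators are
cleared by \<open>\<bar>snd f k\<bar>\<close>, and not by \<open>snd f k\<close>, so that the new form is a positive multiple of \<open>g\<close> on
the hyperplane and has the same sign there.
\<close>

definition eliminate :: "'a \<Rightarrow> int \<times> ('a \<Rightarrow> int) \<Rightarrow> int \<times> ('a \<Rightarrow> int) \<Rightarrow> int \<times> ('a \<Rightarrow> int)" where
  "eliminate k f g =
     (\<bar>snd f k\<bar> * fst g - sgn (snd f k) * snd g k * fst f,
      \<lambda>i. \<bar>snd f k\<bar> * snd g i - sgn (snd f k) * snd g k * snd f i)"

lemma aeval_eliminate:
  fixes x :: "'a \<Rightarrow> 'r::comm_ring_1"
  assumes "finite I" "k \<in> I"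
  shows "aeval (I - {k}) (eliminate k f g) x =
    of_int \<bar>snd f k\<bar> * aeval I g x - of_int (sgn (snd f k) * snd g k) * aeval I f x"
proof -
  let ?h = "\<lambda>i. of_int (snd (eliminate k f g) i) * x i"
  have "\<bar>snd f k\<bar> * snd g k - sgn (snd f k) * snd g k * snd f k = 0"
    by (simp add: abs_sgn algebra_simps)
  then have "?h k = 0" unfolding eliminate_def snd_conv by (simp only: of_int_0 mult_zero_left)
  then have "(\<Sum>i\<in>I - {k}. ?h i) = (\<Sum>i\<in>I. ?h i)"
    using sum.remove[OF assms, of ?h] by simp
  also have "\<dots> = of_int \<bar>snd f k\<bar> * (\<Sum>i\<in>I. of_int (snd g i) * x i)
      - of_int (sgn (snd f k) * snd g k) * (\<Sum>i\<in>I. of_int (snd f i) * x i)"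
    by (simp add: eliminate_def sum_distrib_left sum_subtractf[symmetric] algebra_simps)
  finally show ?thesis
    by (simp add: aeval_def eliminate_def algebra_simps)
qed

lemma aeval_fun_upd:
  fixes x :: "'a \<Rightarrow> 'r::comm_ring_1"
  assumes "finite I" "k \<in> I"
  shows "aeval I f (x(k := t)) = aeval I f x + of_int (snd f k) * (t - x k)"
proof -
  have "(\<Sum>i\<in>I - {k}. of_int (snd f i) * (x(k := t)) i) = (\<Sum>i\<in>I - {k}. of_int (snd f i) * x i)"
    by (rule sum.cong) auto
  then show ?thesis
    unfolding aeval_def sum.remove[OF assms, of "\<lambda>i. of_int (snd f i) * (x(k := t)) i"]
      sum.remove[OF assms, of "\<lambda>i. of_int (snd f i) * x i"]
    by (simp add: algebra_simps)
qed

lemma aeval_cong: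
  "(\<And>i. i \<in> I \<Longrightarrow> x i = y i) \<Longrightarrow> aeval I f x = aeval I f y"
  by (simp add: aeval_def)

section \<open>Deletion and restriction for sign vectors\<close>

definition sign_vectors :: "'a set \<Rightarrow> (int \<times> ('a \<Rightarrow> int)) list \<Rightarrow> bool list set" where
  "sign_vectors I fs =
     {map (\<lambda>f. 0 < aeval I f x) fs | x :: 'a \<Rightarrow> real. \<forall>f\<in>set fs. aeval I f x \<noteq> 0}"

lemma finite_sign_vectors: "finite (sign_vectors I fs)"
proof (rule finite_subset)
  show "sign_vectors I fs \<subseteq> {l. set l \<subseteq> UNIV \<and> length l = length fs}"
    by (auto simp: sign_vectors_def)
  show "finite {l. set l \<subseteq> (UNIV::bool set) \<and> length l = length fs}"
    by (rule finite_lists_length_eq) simp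
qed

lemma perturb_coordinate:
  fixes x :: "'a \<Rightarrow> real"
  assumes "finite I" "k \<in> I" "\<forall>g\<in>set fs. aeval I g x \<noteq> 0"
  shows "\<forall>\<^sub>F t in nhds (x k). \<forall>g\<in>set fs. sgn (aeval I g (x(k := t))) = sgn (aeval I g x)"
proof (rule eventually_ball_finite[OF finite_set], rule ballI)
  fix g assume g: "g \<in> set fs"
  have lim: "((\<lambda>t. aeval I g (x(k := t))) \<longlongrightarrow> aeval I g x) (nhds (x k))"
    unfolding aeval_fun_upd[OF assms(1,2)]
    by (rule tendsto_eq_intros filterlim_ident | simp)+
  consider "aeval I g x > 0" | "aeval I g x < 0" using assms(3) g by fastforce
  then show "\<forall>\<^sub>F t in nhds (x k). sgn (aeval I g (x(k := t))) = sgn (aeval I g x)"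
  proof cases
    case 1
    from order_tendstoD(1)[OF lim 1] show ?thesis using 1 by (auto elim!: eventually_mono)
  next
    case 2
    from order_tendstoD(2)[OF lim 2] show ?thesis using 2 by (auto elim!: eventually_mono)
  qed
qed

text \<open>
A point on the hyperplane \<open>f = 0\<close> lies on the boundary of both of its sides: moving the
coordinate \<open>k\<close> slightly makes \<open>f\<close> take either sign, and it is too short a move to change the sign of a form
that does not vanish at the point.
\<close>

lemma perturb_off_hyperplane:
  fixes x :: "'a \<Rightarrow> real"
  assumes I: "finite I" "k \<in> I" and c: "snd f k \<noteq> 0" and f0: "aeval I f x = 0"
    and nz: "\<forall>g\<in>set fs. aeval I g x \<noteq> 0"
  shows "\<exists>y. (0 < aeval I f y \<longleftrightarrow> b) \<and> aeval I f y \<noteq> 0 \<and>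
           (\<forall>g\<in>set fs. sgn (aeval I g y) = sgn (aeval I g x))"
proof -
  obtain e where e: "e > 0"
    "\<And>t. dist t (x k) < e \<Longrightarrow> \<forall>g\<in>set fs. sgn (aeval I g (x(k := t))) = sgn (aeval I g x)"
    using perturb_coordinate[OF I nz] by (auto simp: eventually_nhds_metric)
  \<comment> \<open>Moving coordinate \<open>k\<close> in direction \<open>s\<close> gives \<open>f\<close> the sign that \<open>b\<close> asks for.\<close>
  define s :: real where "s = (if b then 1 else -1) * sgn (of_int (snd f k))"
  define t where "t = x k + s * e / 2"
  have s: "\<bar>s\<bar> = 1" using c by (auto simp: s_def abs_mult abs_sgn_eq)
  have "dist t (x k) < e" using e(1) s by (simp add: t_def dist_real_def abs_mult)
  moreover have "aeval I f (x(k := t)) = (if b then 1 else -1) * (\<bar>of_int (snd f k)\<bar> * (e / 2))"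
    unfolding aeval_fun_upd[OF I] f0 by (simp add: t_def s_def abs_sgn)
  moreover have "\<bar>of_int (snd f k)\<bar> * (e / 2) > 0" using c e(1) by simp
  ultimately have "0 < aeval I f (x(k := t)) \<longleftrightarrow> b" "aeval I f (x(k := t)) \<noteq> 0"
    "\<forall>g\<in>set fs. sgn (aeval I g (x(k := t))) = sgn (aeval I g x)"
    using e(2) by (cases b; fastforce)+
  then show ?thesis by blast
qed

lemma aeval_segment:
  fixes x y :: "'a \<Rightarrow> real"
  shows "aeval I f (\<lambda>i. (1 - t) * x i + t * y i) = (1 - t) * aeval I f x + t * aeval I f y"
  by (simp add: aeval_def sum.distrib sum_distrib_left algebra_simps sum_subtractf)

lemma combination_signs:
  fixes a b t :: real
  assumes "0 \<le> t" "t \<le> 1" "a \<noteq> 0" "b \<noteq> 0" "0 < a \<longleftrightarrow> 0 < b"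
  shows "(1 - t) * a + t * b \<noteq> 0" "0 < (1 - t) * a + t * b \<longleftrightarrow> 0 < a"
proof -
  have "0 < (1 - t) * a + t * b" if "0 < a" "0 < b" for a b :: real
    using that assms(1,2)
    by (cases "t = 1") (auto intro!: add_pos_nonneg)
  from this[of a b] this[of "- a" "- b"] assms(3-5)
  show "(1 - t) * a + t * b \<noteq> 0" "0 < (1 - t) * a + t * b \<longleftrightarrow> 0 < a" by force+
qed

text \<open>
Split the sign vectors of \<open>f # fs\<close> by the sign of \<open>f\<close>. The union of the two halves is the set of sign
vectors of \<open>fs\<close>, since a point with \<open>f = 0\<close> can be moved off the hyperplane. Their intersection is the
set of sign vectors realised on the hyperplane: points with the same signs on both sides of it are joined
by a segment that crosses it, and conversely a point on it can be moved to either side.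
\<close>

lemma card_sign_vectors_Cons:
  assumes I: "finite I" "k \<in> I" and c: "snd f k \<noteq> 0"
  shows "card (sign_vectors I (f # fs)) =
         card (sign_vectors I fs) + card (sign_vectors (I - {k}) (map (eliminate k f) fs))"
proof -
  define half where "half b = {map (\<lambda>g. 0 < aeval I g x) fs | x :: 'a \<Rightarrow> real.
    (\<forall>g\<in>set (f # fs). aeval I g x \<noteq> 0) \<and> (0 < aeval I f x \<longleftrightarrow> b)}" for b
  have split: "sign_vectors I (f # fs) = (#) True ` half True \<union> (#) False ` half False"
    by (auto simp: sign_vectors_def half_def image_def)
  have sub: "half b \<subseteq> sign_vectors I fs" for b
    by (auto simp: sign_vectors_def half_def)
  have fin: "finite (half b)" for b
    using sub finite_sign_vectors by (rule finite_subset)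
  have un: "half True \<union> half False = sign_vectors I fs"
  proof
    show "sign_vectors I fs \<subseteq> half True \<union> half False"
    proof
      fix v assume "v \<in> sign_vectors I fs"
      then obtain x :: "'a \<Rightarrow> real" where v: "v = map (\<lambda>g. 0 < aeval I g x) fs"
        and nz: "\<forall>g\<in>set fs. aeval I g x \<noteq> 0" by (auto simp: sign_vectors_def)
      show "v \<in> half True \<union> half False"
      proof (cases "aeval I f x = 0")
        case False
        then have "v \<in> half (0 < aeval I f x)" using nz by (auto simp: half_def v)
        then show ?thesis by (cases "0 < aeval I f x") auto
      next
        case True
        obtain y where y: "0 < aeval I f y" "\<forall>g\<in>set fs. sgn (aeval I g y) = sgn (aeval I g x)"
          using perturb_off_hyperplane[OF I c True nz, of True] by auto
        then have "v = map (\<lambda>g. 0 < aeval I g y) fs"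
          unfolding v by (auto simp: sgn_if split: if_splits)
        moreover have "\<forall>g\<in>set fs. aeval I g y \<noteq> 0"
          using y(2) nz by (metis sgn_0_0)
        ultimately have "v \<in> half True" using y(1) by (auto simp: half_def)
        then show ?thesis by simp
      qed
    qed
  qed (use sub in blast)
  have on_hyperplane: "aeval (I - {k}) (eliminate k f g) x = of_int \<bar>snd f k\<bar> * aeval I g x"
    if "aeval I f x = 0" for g and x :: "'a \<Rightarrow> real"
    using that by (simp add: aeval_eliminate[OF I])
  have int: "half True \<inter> half False = sign_vectors (I - {k}) (map (eliminate k f) fs)"
  proof
    show "half True \<inter> half False \<subseteq> sign_vectors (I - {k}) (map (eliminate k f) fs)"
    proof
      fix v assume "v \<in> half True \<inter> half False"
      then obtain x y :: "'a \<Rightarrow> real" where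
        x: "v = map (\<lambda>g. 0 < aeval I g x) fs" "\<forall>g\<in>set fs. aeval I g x \<noteq> 0" "0 < aeval I f x" and
        y: "v = map (\<lambda>g. 0 < aeval I g y) fs" "\<forall>g\<in>set fs. aeval I g y \<noteq> 0" "aeval I f y < 0"
        unfolding half_def Int_iff mem_Collect_eq
        by (metis less_linear list.set_intros)
      \<comment> \<open>The parameter at which the segment from \<open>x\<close> to \<open>y\<close> meets the hyperplane.\<close>
      define t where "t = aeval I f x / (aeval I f x - aeval I f y)"
      have t: "0 \<le> t" "t \<le> 1" using x(3) y(3) by (auto simp: t_def field_simps)
      define z where "z i = (1 - t) * x i + t * y i" for i
      have z: "aeval I g z = (1 - t) * aeval I g x + t * aeval I g y" for g
        unfolding z_def by (rule aeval_segment)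
      have z0: "aeval I f z = 0" using x(3) y(3) by (simp add: z t_def field_simps)
      have same: "0 < aeval I g x \<longleftrightarrow> 0 < aeval I g y" if "g \<in> set fs" for g
        using x(1) y(1) that by auto
      have "aeval I g z \<noteq> 0" "0 < aeval I g z \<longleftrightarrow> 0 < aeval I g x" if "g \<in> set fs" for g
        unfolding z using combination_signs[OF t _ _ same[OF that]] x(2) y(2) that by auto
      then show "v \<in> sign_vectors (I - {k}) (map (eliminate k f) fs)"
        using c by (auto simp: sign_vectors_def x(1) on_hyperplane[OF z0] zero_less_mult_iff
            intro!: exI[of _ z])
    qed
    show "sign_vectors (I - {k}) (map (eliminate k f) fs) \<subseteq> half True \<inter> half False"
    proof
      fix v assume "v \<in> sign_vectors (I - {k}) (map (eliminate k f) fs)"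
      then obtain x0 :: "'a \<Rightarrow> real" where
        "v = map (\<lambda>h. 0 < aeval (I - {k}) h x0) (map (eliminate k f) fs)"
        "\<forall>h\<in>set (map (eliminate k f) fs). aeval (I - {k}) h x0 \<noteq> 0"
        unfolding sign_vectors_def by blast
      then have v0: "v = map (\<lambda>g. 0 < aeval (I - {k}) (eliminate k f g) x0) fs"
        and nz0: "\<forall>g\<in>set fs. aeval (I - {k}) (eliminate k f g) x0 \<noteq> 0" by auto
      define x where "x = x0(k := x0 k - aeval I f x0 / of_int (snd f k))"
      have f0: "aeval I f x = 0" unfolding x_def aeval_fun_upd[OF I] using c by simp
      have eq: "aeval (I - {k}) (eliminate k f g) x0 = of_int \<bar>snd f k\<bar> * aeval I g x" for g
        unfolding on_hyperplane[OF f0, symmetric] by (rule aeval_cong) (auto simp: x_def)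
      have nz: "\<forall>g\<in>set fs. aeval I g x \<noteq> 0" using nz0 by (auto simp: eq)
      have v: "v = map (\<lambda>g. 0 < aeval I g x) fs"
        unfolding v0 eq using c by (auto simp: zero_less_mult_iff)
      have "v \<in> half b" for b
      proof -
        obtain y where y: "0 < aeval I f y \<longleftrightarrow> b" "aeval I f y \<noteq> 0"
          "\<forall>g\<in>set fs. sgn (aeval I g y) = sgn (aeval I g x)"
          using perturb_off_hyperplane[OF I c f0 nz, of b] by auto
        then have "v = map (\<lambda>g. 0 < aeval I g y) fs"
          unfolding v by (auto simp: sgn_if split: if_splits)
        moreover have "\<forall>g\<in>set fs. aeval I g y \<noteq> 0"
          using y(3) nz by (metis sgn_0_0)
        ultimately show ?thesis using y(1,2) by (auto simp: half_def)
      qed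
      then show "v \<in> half True \<inter> half False" by blast
    qed
  qed
  have "card (sign_vectors I (f # fs)) = card (half True) + card (half False)"
    unfolding split by (subst card_Un_disjoint) (auto simp: fin card_image)
  also have "\<dots> = card (half True \<union> half False) + card (half True \<inter> half False)"
    by (rule card_Un_Int) (auto simp: fin)
  finally show ?thesis by (simp add: un int)
qed

section \<open>Deletion and restriction for points modulo a prime\<close>

definition residue_points :: "int \<Rightarrow> 'a set \<Rightarrow> (int \<times> ('a \<Rightarrow> int)) list \<Rightarrow> ('a \<Rightarrow> int) set" where
  "residue_points p I fs =
     {x \<in> I \<rightarrow>\<^sub>E {0..<p}. \<forall>f\<in>set fs. \<not> p dvd aeval I f x}"

lemma finite_residue_points: "finite I \<Longrightarrow> finite (residue_points p I fs)"
  unfolding residue_points_def by (rule finite_subset[OF _ finite_PiE[of I "\<lambda>_. {0..<p}"]]) auto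

text \<open>
The points of \<open>fs\<close> at which \<open>f\<close> vanishes modulo \<open>p\<close> are in bijection with the points of the restricted
forms: since the coefficient of \<open>k\<close> is invertible modulo \<open>p\<close>, the other coordinates determine
coordinate \<open>k\<close>, and on such points the restriction of a form is congruent to a unit times the form.
\<close>

lemma card_residue_points_Cons:
  assumes I: "finite I" "k \<in> I" and p: "p > 0" and cop: "coprime (snd f k) p"
  shows "card (residue_points p I fs) =
         card (residue_points p I (f # fs)) + card (residue_points p (I - {k}) (map (eliminate k f) fs))"
proof -
  define Z where "Z = {x \<in> residue_points p I fs. p dvd aeval I f x}"
  have cabs: "coprime p \<bar>snd f k\<bar>"
    using cop by (simp add: coprime_commute)
  have elim_dvd: "p dvd aeval (I - {k}) (eliminate k f g) x \<longleftrightarrow> p dvd aeval I g x"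
    if "p dvd aeval I f x" for g x
  proof -
    have "p dvd aeval (I - {k}) (eliminate k f g) x \<longleftrightarrow> p dvd \<bar>snd f k\<bar> * aeval I g x"
      unfolding aeval_eliminate[OF I] using that by (simp add: dvd_diff_left_iff)
    also have "\<dots> \<longleftrightarrow> p dvd aeval I g x" using cabs by (rule coprime_dvd_mult_right_iff)
    finally show ?thesis .
  qed
  have "bij_betw (\<lambda>x. restrict x (I - {k})) Z (residue_points p (I - {k}) (map (eliminate k f) fs))"
  proof (rule bij_betwI')
    fix x y assume x: "x \<in> Z" and y: "y \<in> Z"
    show "restrict x (I - {k}) = restrict y (I - {k}) \<longleftrightarrow> x = y"
    proof
      assume r: "restrict x (I - {k}) = restrict y (I - {k})"
      have agree: "x i = y i" if "i \<noteq> k" for i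
      proof (cases "i \<in> I")
        case True
        then show ?thesis using that fun_cong[OF r, of i] by simp
      next
        case False
        then show ?thesis using x y by (simp add: Z_def residue_points_def PiE_iff extensional_def)
      qed
      then have "y = x(k := y k)" by (auto simp: fun_eq_iff)
      then have "aeval I f y = aeval I f x + snd f k * (y k - x k)"
        using aeval_fun_upd[OF I, of f x "y k"] by simp
      then have "p dvd snd f k * (y k - x k)"
        using x y by (simp add: Z_def dvd_add_right_iff)
      then have "p dvd y k - x k"
        using cop by (simp add: coprime_commute coprime_dvd_mult_right_iff)
      moreover have "x k \<in> {0..<p}" "y k \<in> {0..<p}"
        using x y I(2) by (auto simp: Z_def residue_points_def PiE_iff)
      then have "\<bar>y k - x k\<bar> < p" by auto
      ultimately have "y k = x k" using zdvd_not_zless[of "\<bar>y k - x k\<bar>" p] by fastforce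
      with agree show "x = y" by (metis ext)
    qed simp
  next
    fix x assume x: "x \<in> Z"
    have "aeval (I - {k}) h (restrict x (I - {k})) = aeval (I - {k}) h x" for h
      by (rule aeval_cong) simp
    then show "restrict x (I - {k}) \<in> residue_points p (I - {k}) (map (eliminate k f) fs)"
      using x by (auto simp: Z_def residue_points_def elim_dvd)
  next
    fix x0 assume x0: "x0 \<in> residue_points p (I - {k}) (map (eliminate k f) fs)"
    obtain u where u: "[snd f k * u = 1] (mod p)" using cong_solve_coprime_int[OF cop] by blast
    define r where "r = aeval I f (x0(k := 0))"
    define x where "x = x0(k := (- r * u) mod p)"
    have "aeval I f x = r + snd f k * ((- r * u) mod p)"
      using aeval_fun_upd[OF I, of f "x0(k := 0)" "(- r * u) mod p"] by (simp add: x_def r_def)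
    also have "[\<dots> = r + snd f k * (- r * u)] (mod p)"
      by (intro cong_add cong_mult cong_refl) (simp add: cong_def)
    also have "r + snd f k * (- r * u) = r - r * (snd f k * u)" by (simp add: algebra_simps)
    also have "[r - r * (snd f k * u) = r - r * 1] (mod p)"
      by (intro cong_diff cong_mult cong_refl u)
    finally have f0: "p dvd aeval I f x" by (simp add: cong_0_iff)
    have eq: "aeval (I - {k}) h x0 = aeval (I - {k}) h x" for h
      by (rule aeval_cong) (simp add: x_def)
    have "x \<in> I \<rightarrow>\<^sub>E {0..<p}"
      using x0 I(2) p by (auto simp: x_def residue_points_def PiE_iff extensional_def)
    then have "x \<in> Z"
      using x0 f0 by (auto simp: Z_def residue_points_def eq elim_dvd)
    moreover have "x0 = restrict x (I - {k})"
      using x0 by (auto simp: x_def residue_points_def PiE_iff extensional_def fun_eq_iff)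
    ultimately show "\<exists>x\<in>Z. x0 = restrict x (I - {k})" by blast
  qed
  then have "card Z = card (residue_points p (I - {k}) (map (eliminate k f) fs))"
    by (rule bij_betw_same_card)
  moreover have "residue_points p I fs = residue_points p I (f # fs) \<union> Z"
    "residue_points p I (f # fs) \<inter> Z = {}"
    by (auto simp: Z_def residue_points_def)
  moreover have "finite Z" unfolding Z_def using finite_residue_points[OF I(1)] by simp
  ultimately show ?thesis
    using finite_residue_points[OF I(1)] by (simp add: card_Un_disjoint)
qed

section \<open>The characteristic polynomial\<close>

text \<open>
The recursions of \<open>card_sign_vectors_Cons\<close> and \<open>card_residue_points_Cons\<close> differ only in a sign, which
\<open>(-1) ^ card I\<close> absorbs because restriction lowers the dimension by one. Primes that divide a coefficient
used for an elimination, or a nonzero constant form, are excluded by the bound \<open>B\<close>.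
\<close>

theorem characteristic_polynomial:
  assumes "finite I"
  shows "\<exists>P :: int poly. \<exists>B. (\<forall>p. prime p \<longrightarrow> p > B \<longrightarrow> int (card (residue_points p I fs)) = poly P p) \<and>
           int (card (sign_vectors I fs)) = (- 1) ^ card I * poly P (- 1)"
  using assms
proof (induction "length fs" arbitrary: I fs)
  case 0
  then have fs: "fs = []" by simp
  have "int (card (residue_points p I fs)) = poly (monom 1 (card I)) p" if "prime p" for p
  proof -
    have "residue_points p I fs = I \<rightarrow>\<^sub>E {0..<p}" by (simp add: residue_points_def fs)
    then show ?thesis using 0 prime_gt_0_int[OF that] by (simp add: card_PiE poly_monom)
  qed
  moreover have "sign_vectors I fs = {[]}" by (simp add: sign_vectors_def fs)
  moreover have "(- 1 :: int) ^ card I * (- 1) ^ card I = 1"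
    by (simp flip: power_add)
  ultimately show ?case
    by (intro exI[of _ "monom 1 (card I)"] exI[of _ 0]) (simp add: poly_monom)
next
  case (Suc m)
  then obtain f fs' where fs: "fs = f # fs'" "length fs' = m" by (cases fs) auto
  obtain P B where P: "\<And>p. prime p \<Longrightarrow> p > B \<Longrightarrow> int (card (residue_points p I fs')) = poly P p"
    "int (card (sign_vectors I fs')) = (- 1) ^ card I * poly P (- 1)"
    using Suc(1)[of fs' I] fs Suc.prems by blast
  show ?case
  proof (cases "\<exists>k\<in>I. snd f k \<noteq> 0")
    case True
    then obtain k where k: "k \<in> I" "snd f k \<noteq> 0" by blast
    let ?es = "map (eliminate k f) fs'"
    obtain Q C where Q: "\<And>p. prime p \<Longrightarrow> p > C \<Longrightarrow> int (card (residue_points p (I - {k}) ?es)) = poly Q p"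
      "int (card (sign_vectors (I - {k}) ?es)) = (- 1) ^ card (I - {k}) * poly Q (- 1)"
      using Suc(1)[of ?es "I - {k}"] fs Suc.prems by auto
    have "int (card (residue_points p I fs)) = poly (P - Q) p"
      if p: "prime p" "p > max \<bar>snd f k\<bar> (max B C)" for p
    proof -
      have "\<not> p dvd snd f k"
        using p k(2) zdvd_not_zless[of "\<bar>snd f k\<bar>" p] by auto
      then have "coprime (snd f k) p"
        using p(1) prime_imp_coprime coprime_commute by blast
      then show ?thesis
        using card_residue_points_Cons[OF Suc.prems k(1) prime_gt_0_int[OF p(1)], of f fs']
          P(1)[OF p(1)] Q(1)[OF p(1)] p(2) by (simp add: fs)
    qed
    moreover have "card I = Suc (card (I - {k}))"
      using Suc.prems k(1) by (metis card.remove)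
    then have "int (card (sign_vectors I fs)) = (- 1) ^ card I * poly (P - Q) (- 1)"
      using card_sign_vectors_Cons[OF Suc.prems k, of fs'] P(2) Q(2)
      by (simp add: fs algebra_simps)
    ultimately show ?thesis by blast
  next
    case False
    then have const: "aeval I f x = of_int (fst f)" for x :: "'a \<Rightarrow> 'r::comm_ring_1"
      by (simp add: aeval_def)
    show ?thesis
    proof (cases "fst f = 0")
      case True
      then have "sign_vectors I fs = {}" "\<And>p. residue_points p I fs = {}"
        by (auto simp: sign_vectors_def residue_points_def fs const)
      then show ?thesis by (intro exI[of _ 0]) simp
    next
      case c: False
      have "sign_vectors I fs = (#) (0 < fst f) ` sign_vectors I fs'"
        using c by (auto simp: sign_vectors_def fs const)
      then have "card (sign_vectors I fs) = card (sign_vectors I fs')"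
        by (simp add: card_image)
      moreover have "residue_points p I fs = residue_points p I fs'" if "p > \<bar>fst f\<bar>" for p
        using that c zdvd_not_zless[of "\<bar>fst f\<bar>" p] by (auto simp: residue_points_def fs const)
      ultimately show ?thesis using P
        by (intro exI[of _ P] exI[of _ "max B \<bar>fst f\<bar>"]) auto
    qed
  qed
qed

section \<open>Placements of labels and gaps\<close>

text \<open>
The labels are integers, in a finite set \<open>L\<close>, and \<open>y a\<close> is the position of label \<open>a\<close>. As position \<open>0\<close> is
empty, there are \<open>y a - card {b \<in> L. y b < y a}\<close> empty positions before \<open>a\<close>, so that with the gaps
numbered from \<open>0\<close> the number of the gap that contains \<open>a\<close> is one less.
\<close>

definition gap :: "int set \<Rightarrow> (int \<Rightarrow> int) \<Rightarrow> int \<Rightarrow> int" where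
  "gap L y a = y a - 1 - int (card {b \<in> L. y b < y a})"

text \<open>
The left-to-right order that gap numbers force on the labels: by gap, and inside a gap increasing.
\<close>

definition precedes :: "(int \<Rightarrow> int) \<Rightarrow> int \<Rightarrow> int \<Rightarrow> bool" where
  "precedes G b a \<longleftrightarrow> G b < G a \<or> G b = G a \<and> b < a"

definition place :: "int set \<Rightarrow> (int \<Rightarrow> int) \<Rightarrow> int \<Rightarrow> int" where
  "place L G a = G a + 1 + int (card {b \<in> L. precedes G b a})"

text \<open>
The residues modulo \<open>p\<close> are cut open at \<open>0\<close>, which must stay empty, so that neighbours on the cycle
that both carry a label are neighbours as integers. The last condition makes their labels increase.
\<close>

definition admissible :: "int \<Rightarrow> int set \<Rightarrow> (int \<Rightarrow> int) \<Rightarrow> bool" where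
  "admissible p L y \<longleftrightarrow> (\<forall>a\<in>L. 0 < y a \<and> y a < p) \<and> inj_on y L \<and>
     (\<forall>a\<in>L. \<forall>b\<in>L. a < b \<longrightarrow> y a \<noteq> y b + 1)"

lemma gap_cong: "(\<And>a. a \<in> L \<Longrightarrow> y a = z a) \<Longrightarrow> a \<in> L \<Longrightarrow> gap L y a = gap L z a"
  unfolding gap_def by (metis (mono_tags, lifting) Collect_cong)

lemma place_cong: "(\<And>a. a \<in> L \<Longrightarrow> y a = z a) \<Longrightarrow> a \<in> L \<Longrightarrow> place L y a = place L z a"
proof -
  assume *: "\<And>a. a \<in> L \<Longrightarrow> y a = z a" "a \<in> L"
  then have "{b \<in> L. precedes y b a} = {b \<in> L. precedes z b a}" by (auto simp: precedes_def)
  with * show "place L y a = place L z a" by (simp add: place_def)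
qed

text \<open>
Between the positions of \<open>b\<close> and \<open>a\<close> there are at least as many positions as labels, so the gap number
does not decrease. If it stays the same, all these positions are occupied, and the labels increase step
by step from \<open>b\<close> to \<open>a\<close>.
\<close>

lemma gap_mono:
  assumes L: "finite L" and y: "admissible p L y" and ab: "a \<in> L" "b \<in> L" "y b < y a"
  shows "precedes (gap L y) b a"
proof -
  define C where "C = {c \<in> L. y b \<le> y c \<and> y c < y a}"
  have "{c \<in> L. y c < y a} = {c \<in> L. y c < y b} \<union> C" "{c \<in> L. y c < y b} \<inter> C = {}"
    using ab(3) by (auto simp: C_def)
  then have "card {c \<in> L. y c < y a} = card {c \<in> L. y c < y b} + card C"
    using L by (simp add: card_Un_disjoint C_def)
  then have diff: "gap L y a - gap L y b = y a - y b - int (card C)"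
    by (simp add: gap_def)
  have inj: "inj_on y L" using y by (simp add: admissible_def)
  then have cC: "card (y ` C) = card C" by (intro card_image inj_on_subset[OF inj]) (auto simp: C_def)
  have sub: "y ` C \<subseteq> {y b..<y a}" by (auto simp: C_def)
  have "card C \<le> card {y b..<y a}" using card_mono[OF _ sub] cC by simp
  then have le: "int (card C) \<le> y a - y b" using ab(3) by simp
  show ?thesis
  proof (cases "int (card C) = y a - y b")
    case False
    then show ?thesis using le diff by (simp add: precedes_def)
  next
    case True
    then have full: "y ` C = {y b..<y a}"
      using ab(3) cC by (intro card_subset_eq[OF _ sub]) auto
    \<comment> \<open>Walk from \<open>b\<close> to the right over occupied positions; the labels met never drop below \<open>b\<close>.\<close>
    have run: "y b + int n \<le> y a \<Longrightarrow> \<exists>d\<in>L. y d = y b + int n \<and> b \<le> d" for n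
    proof (induction n)
      case 0
      then show ?case using ab by auto
    next
      case (Suc n)
      then obtain d where d: "d \<in> L" "y d = y b + int n" "b \<le> d" by auto
      obtain e where e: "e \<in> L" "y e = y b + int (Suc n)"
      proof (cases "y b + int (Suc n) = y a")
        case True
        then show ?thesis using ab that by auto
      next
        case False
        then have "y b + int (Suc n) \<in> y ` C" using Suc.prems by (auto simp: full)
        then show ?thesis using that by (auto simp: C_def)
      qed
      then have "y e = y d + 1" using d(2) by simp
      then have "\<not> e < d" using y d(1) e(1) by (auto simp: admissible_def)
      then show ?case using d e by auto
    qed
    obtain d where "d \<in> L" "y d = y a" "b \<le> d"
      using run[of "nat (y a - y b)"] ab(3) by auto
    then have "b \<le> a" using inj ab(1) by (auto dest: inj_onD)
    then show ?thesis using True diff ab(3) by (auto simp: precedes_def less_le)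
  qed
qed

lemma precedes_asym: "precedes G a b \<Longrightarrow> \<not> precedes G b a"
  and precedes_trans: "precedes G a b \<Longrightarrow> precedes G b c \<Longrightarrow> precedes G a c"
  and precedes_linear: "a \<noteq> b \<Longrightarrow> precedes G a b \<or> precedes G b a"
  by (auto simp: precedes_def)

text \<open>
So \<open>gap\<close> loses no information: the gap numbers recover the order of the labels, and with it, in
\<open>place_gap\<close>, the positions.
\<close>

lemma precedes_gap_iff:
  assumes "finite L" "admissible p L y" "a \<in> L" "b \<in> L"
  shows "precedes (gap L y) b a \<longleftrightarrow> y b < y a"
proof (cases "y b = y a")
  case True
  then have "b = a" using assms by (auto simp: admissible_def dest: inj_onD)
  then show ?thesis by (simp add: precedes_def)
next
  case False
  then show ?thesis
    using gap_mono[OF assms(1,2)] assms(3,4) precedes_asym by (meson linorder_neqE_linordered_idom)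
qed

lemma place_gap:
  assumes "finite L" "admissible p L y" "a \<in> L"
  shows "place L (gap L y) a = y a"
proof -
  have "{b \<in> L. precedes (gap L y) b a} = {b \<in> L. y b < y a}"
    using precedes_gap_iff[OF assms] by blast
  then show ?thesis by (simp add: place_def gap_def)
qed

lemma gap_range:
  assumes L: "finite L" and y: "admissible p L y" and a: "a \<in> L"
  shows "0 \<le> gap L y a" "gap L y a < p - int (card L)"
proof -
  have inj: "inj_on y L" and r: "\<And>b. b \<in> L \<Longrightarrow> 0 < y b \<and> y b < p"
    using y by (auto simp: admissible_def)
  let ?B = "{b \<in> L. y b < y a}" and ?D = "{b \<in> L. y a \<le> y b}"
  have "card ?B \<le> card {1..<y a}"
    using r by (intro card_inj_on_le[of y]) (force intro!: inj_on_subset[OF inj])+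
  then have "int (card ?B) \<le> y a - 1" using r[OF a] by (simp add: le_nat_iff)
  then show "0 \<le> gap L y a" by (simp add: gap_def)
  have "card ?D \<le> card {y a..<p}"
    using r by (intro card_inj_on_le[of y]) (force intro!: inj_on_subset[OF inj])+
  then have "int (card ?D) \<le> p - y a" using r[OF a] by (simp add: le_nat_iff)
  moreover have "card L = card ?B + card ?D"
    using L by (subst card_Un_disjoint[symmetric]) (auto intro!: arg_cong[of _ _ card])
  ultimately show "gap L y a < p - int (card L)" by (simp add: gap_def)
qed

lemma card_precedes_less:
  assumes L: "finite L" and "b \<in> L" "precedes G b a"
  shows "card {c \<in> L. precedes G c b} < card {c \<in> L. precedes G c a}"
proof (rule psubset_card_mono)
  have "b \<in> {c \<in> L. precedes G c a} - {c \<in> L. precedes G c b}"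
    using assms by (auto simp: precedes_def[of G b b])
  then show "{c \<in> L. precedes G c b} \<subset> {c \<in> L. precedes G c a}"
    using precedes_trans[of G _ b a] assms(3) by blast
qed (use L in simp)

lemma place_less_iff:
  assumes "finite L" "a \<in> L" "b \<in> L"
  shows "place L G b < place L G a \<longleftrightarrow> precedes G b a"
proof -
  have mono: "place L G b < place L G a" if "precedes G b a" "b \<in> L" for a b
    using card_precedes_less[OF assms(1) that(2,1)] that(1)
    by (auto simp: place_def precedes_def)
  show ?thesis
    using mono[of b a] mono[of a b] precedes_linear[of a b G] assms by (cases "a = b") (auto simp: precedes_def)
qed

lemma gap_place:
  assumes "finite L" "a \<in> L"
  shows "gap L (place L G) a = G a"
proof -
  have "{b \<in> L. place L G b < place L G a} = {b \<in> L. precedes G b a}"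
    using place_less_iff[OF assms] by blast
  then show ?thesis by (simp add: gap_def place_def)
qed

lemma admissible_place:
  assumes L: "finite L" and G: "\<And>a. a \<in> L \<Longrightarrow> 0 \<le> G a \<and> G a < p - int (card L)"
  shows "admissible p L (place L G)"
  unfolding admissible_def
proof (intro conjI ballI impI)
  fix a assume a: "a \<in> L"
  show "0 < place L G a" using G[OF a] by (simp add: place_def)
  have "{b \<in> L. precedes G b a} \<subset> L" using a by (auto simp: precedes_def)
  then have "card {b \<in> L. precedes G b a} < card L" by (rule psubset_card_mono[OF L])
  then show "place L G a < p" using G[OF a] by (simp add: place_def)
next
  show "inj_on (place L G) L"
  proof (rule inj_onI)
    fix a b assume "a \<in> L" "b \<in> L" "place L G a = place L G b"
    then show "a = b"
      using place_less_iff[OF L, of a b G] place_less_iff[OF L, of b a G] precedes_linear[of a b G]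
      by auto
  qed
next
  fix a b assume ab: "a \<in> L" "b \<in> L" "a < b"
  show "place L G a \<noteq> place L G b + 1"
  proof
    assume e: "place L G a = place L G b + 1"
    then have pr: "precedes G b a" using place_less_iff[OF L ab(1,2), of G] by simp
    then have "G b < G a" using ab(3) by (auto simp: precedes_def)
    then show False using e card_precedes_less[OF L ab(2) pr] by (simp add: place_def)
  qed
qed

lemma card_reflect:
  assumes "uminus ` L = (L :: int set)"
  shows "card {b \<in> L. P (- b)} = card {b \<in> L. P b}"
  by (rule bij_betw_same_card[of uminus], rule bij_betw_byWitness[of _ uminus])
     (use assms in auto)

text \<open>
Reversal of the positions exchanges the labels before \<open>a\<close> with those after \<open>-a\<close>, so a placement that is
symmetric under negation has symmetric gap numbers; \<open>place_uminus\<close> is the converse.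
\<close>

lemma gap_uminus:
  assumes L: "finite L" "uminus ` L = L" and inj: "inj_on y L"
    and y: "\<And>b. b \<in> L \<Longrightarrow> y (- b) = p - y b" and a: "a \<in> L"
  shows "gap L y (- a) = p - int (card L) - 1 - gap L y a"
proof -
  have "card {b \<in> L. y b < y (- a)} = card {b \<in> L. y (- b) < y (- a)}"
    using card_reflect[OF L(2), of "\<lambda>b. y b < y (- a)"] by simp
  also have "{b \<in> L. y (- b) < y (- a)} = {b \<in> L. y a < y b}" using y a by auto
  finally have 1: "card {b \<in> L. y b < y (- a)} = card {b \<in> L. y a < y b}" .
  have "b \<in> {b \<in> L. y b < y a} \<union> {b \<in> L. y a < y b}" if "b \<in> L" "b \<noteq> a" for b
    using inj_onD[OF inj, of b a] that a less_linear[of "y b" "y a"] by blast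
  then have "L = insert a ({b \<in> L. y b < y a} \<union> {b \<in> L. y a < y b})"
    using a by blast
  then have "card L = card (insert a ({b \<in> L. y b < y a} \<union> {b \<in> L. y a < y b}))" by simp
  also have "\<dots> = Suc (card {b \<in> L. y b < y a} + card {b \<in> L. y a < y b})"
    using L(1) by (simp add: card_Un_disjoint disjoint_iff)
  finally show ?thesis unfolding gap_def 1 using y[OF a] by simp
qed

lemma place_uminus:
  assumes L: "finite L" "uminus ` L = L"
    and G: "\<And>b. b \<in> L \<Longrightarrow> G (- b) = p - int (card L) - 1 - G b" and a: "a \<in> L"
  shows "place L G (- a) = p - place L G a"
proof -
  have "card {b \<in> L. precedes G b (- a)} = card {b \<in> L. precedes G (- b) (- a)}"
    using card_reflect[OF L(2), of "\<lambda>b. precedes G b (- a)"] by simp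
  also have "{b \<in> L. precedes G (- b) (- a)} = {b \<in> L. precedes G a b}"
    using G a by (auto simp: precedes_def)
  finally have 1: "card {b \<in> L. precedes G b (- a)} = card {b \<in> L. precedes G a b}" .
  have "L = insert a ({b \<in> L. precedes G b a} \<union> {b \<in> L. precedes G a b})"
    using a precedes_linear by blast
  then have "card L = card (insert a ({b \<in> L. precedes G b a} \<union> {b \<in> L. precedes G a b}))" by simp
  also have "\<dots> = Suc (card {b \<in> L. precedes G b a} + card {b \<in> L. precedes G a b})"
  proof -
    have "{b \<in> L. precedes G b a} \<inter> {b \<in> L. precedes G a b} = {}" "\<not> precedes G a a"
      using precedes_asym by blast+
    then show ?thesis using L(1) by (simp add: card_Un_disjoint)
  qed
  finally show ?thesis unfolding place_def 1 using G[OF a] by simp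
qed

section \<open>The forms of the Shi arrangement\<close>

definition difference_form :: "int \<Rightarrow> 'n \<Rightarrow> 'n \<Rightarrow> int \<times> ('n \<Rightarrow> int)" where
  "difference_form s i j = (- s, \<lambda>k. of_bool (k = i) - of_bool (k = j))"

definition sum_form :: "int \<Rightarrow> 'n \<Rightarrow> 'n \<Rightarrow> int \<times> ('n \<Rightarrow> int)" where
  "sum_form s i j = (- s, \<lambda>k. of_bool (k = i) + of_bool (k = j))"

text \<open>
The case \<open>i = j\<close> of the sums gives the forms \<open>2 x_k\<close> and \<open>2 x_k - 1\<close>.
\<close>

definition shi_forms :: "(int \<times> ('n::{finite,linorder} \<Rightarrow> int)) set" where
  "shi_forms =
     (\<Union>s\<in>{0, 1}. (\<lambda>(i, j). difference_form s i j) ` {(i, j). i < j} \<union>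
                (\<lambda>(i, j). sum_form s i j) ` {(i, j). i \<le> j})"

lemma aeval_difference_form:
  fixes x :: "'n::finite \<Rightarrow> 'r::comm_ring_1"
  shows "aeval UNIV (difference_form s i j) x = x i - x j - of_int s"
  by (simp add: difference_form_def aeval_def left_diff_distrib sum_subtractf of_bool_def
      if_distrib[of of_int] if_distrib[of "\<lambda>c. c * _"] cong: if_cong)

lemma aeval_sum_form:
  fixes x :: "'n::finite \<Rightarrow> 'r::comm_ring_1"
  shows "aeval UNIV (sum_form s i j) x = x i + x j - of_int s"
  by (simp add: sum_form_def aeval_def distrib_right sum.distrib of_bool_def
      if_distrib[of of_int] if_distrib[of "\<lambda>c. c * _"] cong: if_cong)

lemma finite_shi_forms: "finite (shi_forms :: (int \<times> ('n::{finite,linorder} \<Rightarrow> int)) set)"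
  by (simp add: shi_forms_def)

lemma Ball_shi_forms:
  fixes x :: "'n::{finite,linorder} \<Rightarrow> 'r::comm_ring_1"
  shows "(\<forall>f\<in>shi_forms. P (aeval UNIV f x)) \<longleftrightarrow>
    (\<forall>i j. i < j \<longrightarrow> P (x i - x j) \<and> P (x i - x j - 1)) \<and>
    (\<forall>i j. i \<le> j \<longrightarrow> P (x i + x j) \<and> P (x i + x j - 1))"
  unfolding shi_forms_def
  by (simp add: ball_Un aeval_difference_form aeval_sum_form)
    (rule iffI; elim conjE; intro conjI allI impI; simp)

section \<open>Points of the Shi arrangement modulo p\<close>

text \<open>
Coordinate \<open>k\<close> carries a negative label \<open>lab k\<close>, and its negative carries \<open>- lab k\<close>, so that all
labels of coordinates come before all labels of their negatives. With \<open>c = p\<close> this extends the positions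
of the coordinates to their negatives; with \<open>c\<close> the largest gap number it extends gap numbers
in the same way.
\<close>

definition mirror :: "('n \<Rightarrow> int) \<Rightarrow> int \<Rightarrow> ('n \<Rightarrow> int) \<Rightarrow> int \<Rightarrow> int" where
  "mirror lab c x l = (if l < 0 then x (inv lab l) else c - x (inv lab (- l)))"

text \<open>
Write the point as a placement of labels. The forms \<open>x_i - x_j\<close>, \<open>x_i + x_j\<close> and \<open>2 x_k\<close> are all
nonzero exactly when no label is at \<open>0\<close> and no two labels coincide. Their translates by \<open>1\<close> compare a
smaller label with a larger one, and then are all nonzero exactly when no smaller label comes immediately
after a larger one; for \<open>i < j\<close> the pairs \<open>(i, j)\<close> and \<open>(-j, -i)\<close> give the same form.
\<close>

lemma residue_points_shi:
  fixes lab :: "'n::{finite,linorder} \<Rightarrow> int"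
  assumes lab: "strict_mono lab" "\<And>i. lab i < 0" and fs: "set fs = shi_forms"
    and x: "\<And>i. 0 \<le> x i \<and> x i < p"
  shows "(\<forall>f\<in>set fs. \<not> p dvd aeval UNIV f x) \<longleftrightarrow>
         admissible p (range lab \<union> range (\<lambda>i. - lab i)) (mirror lab p x)"
proof -
  have inj: "inj lab" using lab(1) by (rule strict_mono_imp_inj_on)
  define y where "y = mirror lab p x"
  have y: "y (lab i) = x i" "y (- lab i) = p - x i" for i
    using lab(2)[of i] by (simp_all add: y_def mirror_def inv_f_f[OF inj])
  have less: "lab i < lab j \<longleftrightarrow> i < j" "lab i = lab j \<longleftrightarrow> i = j" for i j
    using lab(1) inj by (auto simp: strict_mono_less dest: injD)
  have neg: "lab i < - lab j" "\<not> - lab i < lab j" "lab i \<noteq> - lab j" "- lab i \<noteq> lab j" for i j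
    using lab(2)[of i] lab(2)[of j] by auto
  \<comment> \<open>The values of the forms are small, so divisibility by \<open>p\<close> amounts to an equation.\<close>
  have small: "p dvd d \<longleftrightarrow> d = 0" if "- p < d" "d < p" for d
    using zdvd_not_zless[of "\<bar>d\<bar>" p] that by (cases "d = 0") auto
  have small2: "p dvd d \<longleftrightarrow> d = p" if "0 < d" "d < 2 * p" for d
  proof -
    have "p dvd d \<longleftrightarrow> p dvd d - p" by (rule dvd_diff_left_iff[symmetric]) simp
    also have "\<dots> \<longleftrightarrow> d - p = 0" using that by (intro small) auto
    finally show ?thesis by simp
  qed
  define Q where "Q \<longleftrightarrow> (\<forall>i. 0 < x i) \<and>
    (\<forall>i j. i < j \<longrightarrow> x i \<noteq> x j \<and> x i \<noteq> x j + 1) \<and>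
    (\<forall>i j. i \<le> j \<longrightarrow> x i + x j \<noteq> p \<and> x i + x j \<noteq> p + 1)"
  have "(\<forall>f\<in>set fs. \<not> p dvd aeval UNIV f x) \<longleftrightarrow> Q"
  proof -
    have pos: "\<forall>i. 0 < x i" if "\<forall>i. \<not> p dvd x i + x i"
    proof
      fix i
      have "x i \<noteq> 0" using that[rule_format, of i] by auto
      then show "0 < x i" using x[of i] by simp
    qed
    have dvds: "(p dvd x i - x j \<longleftrightarrow> x i = x j) \<and> (p dvd x i - x j - 1 \<longleftrightarrow> x i = x j + 1) \<and>
        (p dvd x i + x j \<longleftrightarrow> x i + x j = p) \<and> (p dvd x i + x j - 1 \<longleftrightarrow> x i + x j = p + 1)"
      if "\<forall>i. 0 < x i" for i j
    proof -
      have bounds: "0 < x i" "0 < x j" "x i < p" "x j < p" using that x by auto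
      have "p dvd x i - x j \<longleftrightarrow> x i - x j = 0" "p dvd x i - x j - 1 \<longleftrightarrow> x i - x j - 1 = 0"
        by (rule small; use bounds in linarith)+
      moreover have "p dvd x i + x j \<longleftrightarrow> x i + x j = p" "p dvd x i + x j - 1 \<longleftrightarrow> x i + x j - 1 = p"
        by (rule small2; use bounds in linarith)+
      ultimately show ?thesis by (simp only:) (intro conjI iffI; linarith)
    qed
    show ?thesis
      unfolding fs Ball_shi_forms[of "\<lambda>d. \<not> p dvd d"]
    proof
      assume *: "(\<forall>i j. i < j \<longrightarrow> \<not> p dvd x i - x j \<and> \<not> p dvd x i - x j - 1) \<and>
        (\<forall>i j. i \<le> j \<longrightarrow> \<not> p dvd x i + x j \<and> \<not> p dvd x i + x j - 1)"
      have "\<forall>i. 0 < x i"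
        using *[THEN conjunct2, rule_format, OF order_refl] by (intro pos) blast
      with * show Q unfolding Q_def by (simp add: dvds)
    next
      assume Q
      then show "(\<forall>i j. i < j \<longrightarrow> \<not> p dvd x i - x j \<and> \<not> p dvd x i - x j - 1) \<and>
        (\<forall>i j. i \<le> j \<longrightarrow> \<not> p dvd x i + x j \<and> \<not> p dvd x i + x j - 1)"
        unfolding Q_def by (simp add: dvds)
    qed
  qed
  also have "Q \<longleftrightarrow> admissible p (range lab \<union> range (\<lambda>i. - lab i)) y"
  proof
    assume Q: Q
    note Q' = this[unfolded Q_def]
    note pos = Q'[THEN conjunct1, rule_format]
    note chain = Q'[THEN conjunct2, THEN conjunct1, rule_format]
    note sum = Q'[THEN conjunct2, THEN conjunct2, rule_format]
    have sum': "x i \<noteq> p - x j" "p - x j \<noteq> x i" "x i \<noteq> p - x j + 1" for i j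
    proof -
      have "x i + x j \<noteq> p \<and> x i + x j \<noteq> p + 1"
        using sum[of i j] sum[of j i] linear[of i j] by (metis add.commute)
      then show "x i \<noteq> p - x j" "p - x j \<noteq> x i" "x i \<noteq> p - x j + 1" by linarith+
    qed
    have asc': "i < j \<Longrightarrow> p - x j \<noteq> p - x i + 1" for i j
      using chain[of i j] by linarith
    have ne': "x i = x j \<longleftrightarrow> i = j" for i j
      using chain[of i j] chain[of j i] by (cases i j rule: linorder_cases) auto
    show "admissible p (range lab \<union> range (\<lambda>i. - lab i)) y"
      unfolding admissible_def
    proof (intro conjI ballI impI inj_onI)
      fix a assume "a \<in> range lab \<union> range (\<lambda>i. - lab i)"
      then show "0 < y a" "y a < p" using pos x by (auto simp: y)
    next
      fix a b
      assume "a \<in> range lab \<union> range (\<lambda>i. - lab i)" "b \<in> range lab \<union> range (\<lambda>i. - lab i)"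
        "y a = y b"
      then show "a = b" by (auto simp: y sum' ne')
    next
      fix a b
      assume "a \<in> range lab \<union> range (\<lambda>i. - lab i)" "b \<in> range lab \<union> range (\<lambda>i. - lab i)"
        "a < b"
      then show "y a \<noteq> y b + 1"
        by (elim UnE rangeE) (simp_all add: y less neg chain asc' sum')
    qed
  next
    assume "admissible p (range lab \<union> range (\<lambda>i. - lab i)) y"
    note A' = this[unfolded admissible_def]
    have range: "0 < y a" if "a \<in> range lab \<union> range (\<lambda>i. - lab i)" for a
      using A' that by blast
    have inj: "inj_on y (range lab \<union> range (\<lambda>i. - lab i))"
      using A' by blast
    have asc: "y a \<noteq> y b + 1" if "a \<in> range lab \<union> range (\<lambda>i. - lab i)"
      "b \<in> range lab \<union> range (\<lambda>i. - lab i)" "a < b" for a b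
      using A' that by blast
    have A: "0 < x i" "x i = x j \<longrightarrow> i = j" "i < j \<longrightarrow> x i \<noteq> x j + 1" for i j
      using range[of "lab i"] inj_onD[OF inj, of "lab i" "lab j"] asc[of "lab i" "lab j"]
      by (simp_all add: y less)
    have B: "x i \<noteq> p - x j" "x i \<noteq> p - x j + 1" for i j
    proof -
      have "y (lab i) \<noteq> y (- lab j)"
        using inj_onD[OF inj, of "lab i" "- lab j"] neg(3)[of i j] by blast
      moreover have "y (lab i) \<noteq> y (- lab j) + 1"
        by (rule asc) (simp_all add: neg(1))
      ultimately show "x i \<noteq> p - x j" "x i \<noteq> p - x j + 1" unfolding y by blast+
    qed
    show Q unfolding Q_def
    proof (intro conjI allI impI)
      fix i j :: 'n
      show "0 < x i" by (rule A)
      show "x i + x j \<noteq> p" "x i + x j \<noteq> p + 1" using B[of i j] by linarith+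
      assume "i < j"
      then show "x i \<noteq> x j" "x i \<noteq> x j + 1" using A(2,3)[of i j] by auto
    qed
  qed
  finally show ?thesis by (simp add: y_def)
qed

text \<open>
The maps \<open>gap\<close> and \<open>place\<close> are inverse to each other and respect the symmetry under negation, so
they restrict to a bijection between the points and the arbitrary choices of a gap for each coordinate.
\<close>

lemma card_residue_points_shi:
  assumes fs: "set fs = (shi_forms :: (int \<times> ('n::{finite,linorder} \<Rightarrow> int)) set)"
    and p: "p > 2 * int CARD('n)"
  shows "int (card (residue_points p UNIV fs)) = (p - 2 * int CARD('n)) ^ CARD('n)"
proof -
  \<comment> \<open>Negating the size of the upper set makes the labels increase with the index and be negative.\<close>
  define lab :: "'n \<Rightarrow> int" where "lab i = - int (card {j. i \<le> j})" for i
  define L where "L = range lab \<union> range (\<lambda>i. - lab i)"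
  define m where "m = p - 2 * int CARD('n)"
  have neg: "lab i < 0" for i
    by (auto simp: lab_def card_gt_0_iff)
  have smono: "strict_mono lab"
  proof (rule strict_monoI)
    fix i j :: 'n assume "i < j"
    then have "{k. j \<le> k} \<subseteq> {k. i \<le> k}" "i \<in> {k. i \<le> k} - {k. j \<le> k}" by auto
    then have "{k. j \<le> k} \<subset> {k. i \<le> k}" by blast
    then show "lab i < lab j" by (simp add: lab_def psubset_card_mono)
  qed
  then have inj: "inj lab" by (rule strict_mono_imp_inj_on)
  have L: "finite L" "uminus ` L = L" by (auto simp: L_def image_Un image_image)
  have labL: "lab i \<in> L" "- lab i \<in> L" for i by (auto simp: L_def)
  have "range lab \<inter> range (\<lambda>i. - lab i) = {}"
    using neg by (auto) (metis neg less_asym neg_0_less_iff_less)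
  then have "card L = CARD('n) + CARD('n)"
    using inj by (simp add: L_def card_Un_disjoint card_image inj_def)
  then have m: "m = p - int (card L)" by (simp add: m_def)
  have mir: "mirror lab c x (lab i) = x i" "mirror lab c x (- lab i) = c - x i" for c x i
    using neg[of i] by (simp_all add: mirror_def inv_f_f[OF inj])
  have mir_uminus: "mirror lab c x (- a) = c - mirror lab c x a" if "a \<in> L" for c x a
    using that by (auto simp: L_def mir)
  have mir_eqI: "mirror lab c (\<lambda>i. y (lab i)) a = y a" if "a \<in> L" "\<And>i. y (- lab i) = c - y (lab i)" for c y a
    using that by (auto simp: L_def mir)
  have points: "x \<in> residue_points p UNIV fs \<longleftrightarrow>
      (\<forall>i. 0 \<le> x i \<and> x i < p) \<and> admissible p L (mirror lab p x)" for x
    using residue_points_shi[OF smono neg fs, of x p]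
    by (auto simp: residue_points_def L_def PiE_iff)
  define to_gaps where "to_gaps x i = gap L (mirror lab p x) (lab i)" for x i
  define to_places where "to_places g i = place L (mirror lab (m - 1) g) (lab i)" for g i
  have mir_gaps: "mirror lab (m - 1) (to_gaps x) a = gap L (mirror lab p x) a"
    if "a \<in> L" "admissible p L (mirror lab p x)" for x a
  proof -
    have "gap L (mirror lab p x) (- lab i) = m - 1 - gap L (mirror lab p x) (lab i)" for i
      using gap_uminus[OF L, of "mirror lab p x" p "lab i"] that(2) mir_uminus labL
      by (auto simp: admissible_def m)
    then show ?thesis unfolding to_gaps_def by (rule mir_eqI[OF that(1)])
  qed
  have mir_places: "mirror lab p (to_places g) a = place L (mirror lab (m - 1) g) a"
    if "a \<in> L" for g a
  proof -
    have "place L (mirror lab (m - 1) g) (- lab i) = p - place L (mirror lab (m - 1) g) (lab i)" for i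
      using place_uminus[OF L, of "mirror lab (m - 1) g" p "lab i"] mir_uminus labL
      by (auto simp: m)
    then show ?thesis unfolding to_places_def by (rule mir_eqI[OF that(1)])
  qed
  have adm_cong: "admissible p L y \<longleftrightarrow> admissible p L z" if "\<And>a. a \<in> L \<Longrightarrow> y a = z a" for y z
    using that by (simp add: admissible_def cong: inj_on_cong)
  have "bij_betw to_gaps (residue_points p UNIV fs) (UNIV \<rightarrow>\<^sub>E {0..<m})"
  proof (rule bij_betw_byWitness[of _ to_places])
    show "\<forall>x\<in>residue_points p UNIV fs. to_places (to_gaps x) = x"
    proof
      fix x assume "x \<in> residue_points p UNIV fs"
      then have adm: "admissible p L (mirror lab p x)" by (simp add: points)
      have "to_places (to_gaps x) i = x i" for i
        using place_cong[OF mir_gaps[OF _ adm] labL(1)] place_gap[OF L(1) adm labL(1)]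
        by (simp add: to_places_def[of "to_gaps x"] mir)
      then show "to_places (to_gaps x) = x" ..
    qed
    show "\<forall>g\<in>UNIV \<rightarrow>\<^sub>E {0..<m}. to_gaps (to_places g) = g"
    proof
      fix g :: "'n \<Rightarrow> int"
      have "to_gaps (to_places g) i = g i" for i
        using gap_cong[OF mir_places labL(1)] gap_place[OF L(1) labL(1)]
        by (simp add: to_gaps_def[of "to_places g"] mir)
      then show "to_gaps (to_places g) = g" ..
    qed
    show "to_gaps ` residue_points p UNIV fs \<subseteq> UNIV \<rightarrow>\<^sub>E {0..<m}"
      using gap_range[OF L(1) _ labL(1)] by (auto simp: points to_gaps_def m)
    show "to_places ` (UNIV \<rightarrow>\<^sub>E {0..<m}) \<subseteq> residue_points p UNIV fs"
    proof (rule image_subsetI)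
      fix g :: "'n \<Rightarrow> int" assume g: "g \<in> UNIV \<rightarrow>\<^sub>E {0..<m}"
      have gi: "0 \<le> g i \<and> g i < m" for i using g by auto
      have "0 \<le> mirror lab (m - 1) g a \<and> mirror lab (m - 1) g a < p - int (card L)" if a: "a \<in> L" for a
      proof -
        obtain i where "a = lab i \<or> a = - lab i" using a unfolding L_def by blast
        then show ?thesis unfolding m[symmetric] using gi[of i] by (elim disjE) (simp_all add: mir)
      qed
      then have adm: "admissible p L (place L (mirror lab (m - 1) g))"
        using admissible_place[OF L(1)] by blast
      have "0 < to_places g i \<and> to_places g i < p" for i
        unfolding to_places_def using adm[unfolded admissible_def] labL(1)[of i] by blast
      then have "\<forall>i. 0 \<le> to_places g i \<and> to_places g i < p" using less_imp_le by blast
      moreover have "admissible p L (mirror lab p (to_places g))"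
        using adm adm_cong[of "mirror lab p (to_places g)" "place L (mirror lab (m - 1) g)"]
          mir_places by blast
      ultimately show "to_places g \<in> residue_points p UNIV fs" by (simp add: points)
    qed
  qed
  then have "card (residue_points p UNIV fs) = card ((UNIV :: 'n set) \<rightarrow>\<^sub>E {0..<m})"
    by (rule bij_betw_same_card)
  also have "\<dots> = nat m ^ CARD('n)" by (simp add: card_PiE)
  finally show ?thesis using p by (simp add: m_def)
qed

section \<open>Counting the sign vectors\<close>

text \<open>
The characteristic polynomial agrees with \<open>(t - 2n)^n\<close> at all large primes, hence identically; it
remains to evaluate at \<open>-1\<close>.
\<close>

lemma card_sign_vectors_shi:
  assumes fs: "set fs = (shi_forms :: (int \<times> ('n::{finite,linorder} \<Rightarrow> int)) set)"
  shows "card (sign_vectors UNIV fs) = (2 * CARD('n) + 1) ^ CARD('n)"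
proof -
  let ?n = "CARD('n)"
  obtain P :: "int poly" and B where
    P: "\<forall>p. prime p \<longrightarrow> p > B \<longrightarrow> int (card (residue_points p UNIV fs)) = poly P p" and
    N: "int (card (sign_vectors UNIV fs)) = (- 1) ^ ?n * poly P (- 1)"
    using characteristic_polynomial[of UNIV fs, OF finite] by blast
  define Q where "Q = [: - 2 * int ?n, 1 :] ^ ?n"
  define K where "K = nat (max B (2 * int ?n))"
  have "poly (P - Q) (int q) = 0" if q: "prime q" "K < q" for q
  proof -
    have "prime (int q)" "B < int q" "2 * int ?n < int q" using q by (auto simp: K_def)
    then have "poly P (int q) = (int q - 2 * int ?n) ^ ?n"
      using P card_residue_points_shi[OF fs] by metis
    then show ?thesis by (simp add: Q_def)
  qed
  then have roots: "int ` {q. prime q \<and> K < q} \<subseteq> {x. poly (P - Q) x = 0}" by blast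
  have "infinite {q. prime q \<and> K < q}"
  proof
    assume "finite {q. prime q \<and> K < q}"
    moreover have "{q::nat. prime q} \<subseteq> {q. prime q \<and> K < q} \<union> {..K}" by auto
    ultimately have "finite {q::nat. prime q}" by (meson finite_UnI finite_atMost finite_subset)
    then show False using primes_infinite by blast
  qed
  then have "infinite (int ` {q. prime q \<and> K < q})"
    using finite_imageD[OF _ inj_on_of_nat] by blast
  then have "infinite {x. poly (P - Q) x = 0}" using roots finite_subset by blast
  then have "P - Q = 0" using poly_roots_finite by blast
  then have "P = Q" by simp
  then have "int (card (sign_vectors UNIV fs)) = ((- 1) * (- 2 * int ?n - 1)) ^ ?n"
    unfolding N power_mult_distrib by (simp add: Q_def)
  also have "(- 1) * (- 2 * int ?n - 1) = int (2 * ?n + 1)" by simp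
  finally show ?thesis unfolding of_nat_power[symmetric] of_nat_eq_iff .
qed

section \<open>Regions are sign vectors\<close>

definition cell :: "(int \<times> ('n::finite \<Rightarrow> int)) list \<Rightarrow> bool list \<Rightarrow> (real ^ 'n) set" where
  "cell fs v = {x. (\<forall>f\<in>set fs. aeval UNIV f (vec_nth x) \<noteq> 0) \<and>
                   map (\<lambda>f. 0 < aeval UNIV f (vec_nth x)) fs = v}"

lemma convex_cell:
  fixes fs :: "(int \<times> ('n::finite \<Rightarrow> int)) list"
  shows "convex (cell fs v)"
  unfolding convex_alt
proof (intro ballI allI impI)
  fix x y :: "real ^ 'n" and t :: real
  assume x: "x \<in> cell fs v" and y: "y \<in> cell fs v" and t: "0 \<le> t \<and> t \<le> 1"
  let ?z = "(1 - t) *\<^sub>R x + t *\<^sub>R y"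
  have "vec_nth ?z = (\<lambda>i. (1 - t) * x $ i + t * y $ i)" by auto
  then have z: "aeval UNIV f (vec_nth ?z) = (1 - t) * aeval UNIV f (vec_nth x) + t * aeval UNIV f (vec_nth y)" for f
    using aeval_segment[of UNIV f t "vec_nth x" "vec_nth y"] by simp
  have xy: "aeval UNIV f (vec_nth x) \<noteq> 0" "aeval UNIV f (vec_nth y) \<noteq> 0"
    "0 < aeval UNIV f (vec_nth x) \<longleftrightarrow> 0 < aeval UNIV f (vec_nth y)" if "f \<in> set fs" for f
    using x y that by (auto simp: cell_def)
  have "aeval UNIV f (vec_nth ?z) \<noteq> 0" "0 < aeval UNIV f (vec_nth ?z) \<longleftrightarrow> 0 < aeval UNIV f (vec_nth x)"
    if "f \<in> set fs" for f
    unfolding z using combination_signs[OF conjunct1[OF t] conjunct2[OF t] xy[OF that]] by auto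
  then show "?z \<in> cell fs v" using x by (auto simp: cell_def)
qed

lemma open_cell:
  fixes fs :: "(int \<times> ('n::finite \<Rightarrow> int)) list"
  shows "open (cell fs v)"
proof (cases "cell fs v = {}")
  case False
  then obtain x0 where x0: "x0 \<in> cell fs v" by blast
  let ?side = "\<lambda>f. if 0 < aeval UNIV f (vec_nth x0) then {x::real^'n. 0 < aeval UNIV f (vec_nth x)}
                   else {x. aeval UNIV f (vec_nth x) < 0}"
  have v: "v = map (\<lambda>f. 0 < aeval UNIV f (vec_nth x0)) fs" using x0 by (simp add: cell_def)
  have "x \<in> ?side f \<longleftrightarrow>
    aeval UNIV f (vec_nth x) \<noteq> 0 \<and> (0 < aeval UNIV f (vec_nth x) \<longleftrightarrow> 0 < aeval UNIV f (vec_nth x0))"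
    for f x by (cases "0 < aeval UNIV f (vec_nth x0)") (simp_all, linarith+)
  moreover have "x \<in> cell fs v \<longleftrightarrow> (\<forall>f\<in>set fs.
    aeval UNIV f (vec_nth x) \<noteq> 0 \<and> (0 < aeval UNIV f (vec_nth x) \<longleftrightarrow> 0 < aeval UNIV f (vec_nth x0)))"
    for x unfolding cell_def v mem_Collect_eq map_eq_conv by blast
  ultimately have "cell fs v = (\<Inter>f\<in>set fs. ?side f)" by blast
  moreover have "open (?side f)" for f
  proof -
    have "continuous_on UNIV (\<lambda>x :: real ^ 'n. aeval UNIV f (vec_nth x))"
      unfolding aeval_def by (intro continuous_intros)
    then show ?thesis by (simp add: open_Collect_less)
  qed
  then have "open (\<Inter>f\<in>set fs. ?side f)" by (intro open_INT finite_set ballI)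
  ultimately show ?thesis by (simp only:)
qed simp

lemma cell_nonempty_iff: "cell fs v \<noteq> {} \<longleftrightarrow> v \<in> sign_vectors UNIV fs"
proof
  assume "v \<in> sign_vectors UNIV fs"
  then obtain x :: "'a \<Rightarrow> real" where "v = map (\<lambda>f. 0 < aeval UNIV f x) fs"
    "\<forall>f\<in>set fs. aeval UNIV f x \<noteq> 0" by (auto simp: sign_vectors_def)
  then have "vec_lambda x \<in> cell fs v" by (simp add: cell_def vec_lambda_inverse)
  then show "cell fs v \<noteq> {}" by blast
qed (auto simp: cell_def sign_vectors_def)

lemma components_eq_cells:
  "components {x. \<forall>f\<in>set fs. aeval UNIV f (vec_nth x) \<noteq> 0} = cell fs ` sign_vectors UNIV fs"
proof (rule components_open_unique)
  show "pairwise disjnt (cell fs ` sign_vectors UNIV fs)"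
    by (auto simp: pairwise_def disjnt_def cell_def)
  show "\<Union> (cell fs ` sign_vectors UNIV fs) = {x. \<forall>f\<in>set fs. aeval UNIV f (vec_nth x) \<noteq> 0}"
    by (auto simp: cell_def sign_vectors_def)
  show "open X \<and> connected X \<and> X \<noteq> {}" if "X \<in> cell fs ` sign_vectors UNIV fs" for X
    using that cell_nonempty_iff open_cell convex_cell convex_connected by blast
qed

lemma inj_on_cell: "inj_on (cell fs) (sign_vectors UNIV fs)"
proof (rule inj_onI)
  fix v w assume "v \<in> sign_vectors UNIV fs" "cell fs v = cell fs w"
  moreover from this obtain x where "x \<in> cell fs v" using cell_nonempty_iff by blast
  ultimately show "v = w" by (auto simp: cell_def)
qed

lemma shi_C_complement:
  "UNIV - \<Union> shi_C = {x :: real ^ 'n::{finite,linorder}. \<forall>f\<in>shi_forms. aeval UNIV f (vec_nth x) \<noteq> 0}"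
proof -
  have members: "x \<in> \<Union> {S i j | i j. P i j} \<longleftrightarrow> (\<exists>i j. P i j \<and> x \<in> S i j)"
    "x \<in> \<Union> {T k | k. True} \<longleftrightarrow> (\<exists>k. x \<in> T k)"
    for x :: "(real, 'n) vec" and S :: "'n \<Rightarrow> 'n \<Rightarrow> (real, 'n) vec set" and T :: "'n \<Rightarrow> (real, 'n) vec set" and P
    by blast+
  have "x \<notin> \<Union> shi_C \<longleftrightarrow> (\<forall>f\<in>shi_forms. aeval UNIV f (vec_nth x) \<noteq> 0)"
    (is "?avoids \<longleftrightarrow> ?nonzero") for x :: "(real, 'n) vec"
  proof -
    have avoids: "?avoids \<longleftrightarrow>
      (\<forall>i j. i < j \<longrightarrow> x $ i - x $ j \<noteq> 0) \<and> (\<forall>i j. i < j \<longrightarrow> x $ i + x $ j \<noteq> 0) \<and>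
      (\<forall>k. 2 * x $ k \<noteq> 0) \<and> (\<forall>i j. i < j \<longrightarrow> x $ i - x $ j \<noteq> 1) \<and>
      (\<forall>i j. i < j \<longrightarrow> x $ i + x $ j \<noteq> 1) \<and> (\<forall>k. 2 * x $ k \<noteq> 1)"
      unfolding shi_C_def Union_Un_distrib Un_iff members mem_Collect_eq de_Morgan_disj not_ex
        de_Morgan_conj imp_conv_disj conj_assoc by (rule refl)
    have nonzero: "?nonzero \<longleftrightarrow>
      (\<forall>i j. i < j \<longrightarrow> x $ i - x $ j \<noteq> 0 \<and> x $ i - x $ j \<noteq> 1) \<and>
      (\<forall>i j. i \<le> j \<longrightarrow> x $ i + x $ j \<noteq> 0 \<and> x $ i + x $ j \<noteq> 1)"
      using Ball_shi_forms[of "\<lambda>r. r \<noteq> 0" "vec_nth x"] by (simp only: right_minus_eq)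
    show ?thesis
    proof
      assume ?avoids
      note a = this[unfolded avoids]
      have "x $ i + x $ j \<noteq> 0 \<and> x $ i + x $ j \<noteq> 1" if "i \<le> j" for i j
      proof (cases "i = j")
        case True
        then show ?thesis using a unfolding mult_2 by blast
      next
        case False
        then show ?thesis using a that unfolding le_less by blast
      qed
      then show ?nonzero unfolding nonzero using a by blast
    next
      assume ?nonzero
      note a = this[unfolded nonzero]
      note differences = a[THEN conjunct1, rule_format] and sums = a[THEN conjunct2, rule_format]
      have "2 * x $ k \<noteq> 0 \<and> 2 * x $ k \<noteq> 1" for k
        using sums[of k k, OF order_refl] unfolding mult_2 .
      then show ?avoids unfolding avoids using differences sums[OF less_imp_le] by blast
    qed
  qed
  then show ?thesis by blast
qed

lemma card_regions_shi_C:
  "finite (regions (shi_C :: (real ^ 'n::{finite,linorder}) set set))"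
  "card (regions (shi_C :: (real ^ 'n::{finite,linorder}) set set)) = (2 * CARD('n) + 1) ^ CARD('n)"
proof -
  obtain fs where fs: "set fs = (shi_forms :: (int \<times> ('n \<Rightarrow> int)) set)"
    using finite_list[OF finite_shi_forms] by blast
  have eq: "regions (shi_C :: (real, 'n) vec set set) = cell fs ` sign_vectors UNIV fs"
    unfolding regions_def shi_C_complement fs[symmetric] by (rule components_eq_cells)
  show "finite (regions (shi_C :: (real, 'n) vec set set))"
    unfolding eq using finite_sign_vectors by (rule finite_imageI)
  show "card (regions (shi_C :: (real, 'n) vec set set)) = (2 * CARD('n) + 1) ^ CARD('n)"
    unfolding eq using card_image[OF inj_on_cell[of fs]] card_sign_vectors_shi[OF fs] by simp
qed

lemma card_seqs_C:
  "finite (seqs_C :: (int ^ 'n::finite) set)"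
  "card (seqs_C :: (int ^ 'n::finite) set) = (2 * CARD('n) + 1) ^ CARD('n)"
proof -
  let ?R = "(UNIV :: 'n set) \<rightarrow>\<^sub>E {- int CARD('n)..int CARD('n)}"
  have bij: "bij_betw vec_lambda ?R seqs_C"
    by (rule bij_betw_byWitness[of _ vec_nth]) (auto simp: seqs_C_def)
  then show "finite (seqs_C :: (int, 'n) vec set)"
    using bij_betw_finite[OF bij] by (simp add: finite_PiE)
  show "card (seqs_C :: (int, 'n) vec set) = (2 * CARD('n) + 1) ^ CARD('n)"
  proof -
    have "card (seqs_C :: (int, 'n) vec set) = card ?R"
      using bij_betw_same_card[OF bij] by (rule sym)
    also have "\<dots> = card {- int CARD('n)..int CARD('n)} ^ CARD('n)"
      unfolding card_PiE[OF finite] by (rule prod_constant)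
    also have "card {- int CARD('n)..int CARD('n)} = 2 * CARD('n) + 1"
      unfolding card_atLeastAtMost_int by linarith
    finally show ?thesis .
  qed
qed

theorem theorem3:
  "\<exists>f. bij_betw f (regions (shi_C :: (real ^ 'n::{finite,linorder}) set set))
                 (seqs_C :: (int ^ 'n::{finite,linorder}) set)"
  by (rule finite_same_card_bij[OF card_regions_shi_C(1) card_seqs_C(1)])
    (simp only: card_regions_shi_C(2) card_seqs_C(2))

end
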